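(* Let $\Omega\subset\mathbb{C}^n$ ($n\ge2$) be a bounded domain, let $F$ be a Finsler metric on $\Omega$, and suppose that the associated Finsler distance $d_F$ is complete. Suppose that there exist constants $C_1,C_2,\alpha>0$ and $0<\beta<1$ such that $$d_F(x,y)\ge\alpha\left|\log\left(\frac{\delta(x)}{\delta(y)}\right)\right|-C_1\quad\text{for all }x,y\in\Omega,$$ and $$F(z,X)\ge\frac{C_2|X|}{\delta(z)^\beta}\quad\text{for all }z\in\Omega,\ 0\ne X\in\mathbb{C}^n.$$ Then there is a constant $C>0$ such that for each $x,y\in\Omega$ and each Finsler geodesic $[x,y]$ connecting $x$ and $y$ in $\Omega$, $$d_F(x,y)\ge2\alpha\log\left(\frac{L([x,y])^{1/\beta}+\delta(x)\vee\delta(y)}{\sqrt{\delta(x)\delta(y)}}\right)-C,$$ where $L([x,y])$ denotes the Euclidean length of $[x,y]$.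
   Context: $\delta(x)=\inf\{|x-\xi|:\xi\in\partial\Omega\}$ is the Euclidean distance to the boundary; $a\vee b=\max\{a,b\}$. A Finsler metric on $\Omega$ is an upper semi-continuous map $F:\Omega\times\mathbb{C}^n\to[0,\infty)$ with $F(z;tX)=|t|F(z;X)$ for $z\in\Omega$, $t\in\mathbb{C}$, $X\in\mathbb{C}^n$. The associated distance $d_F(x,y)$ is the infimum of $\int_0^1F(\gamma(t);\dot\gamma(t))\,dt$ over piecewise $C^1$ curves $\gamma:[0,1]\to\Omega$ with $\gamma(0)=x$, $\gamma(1)=y$. A Finsler geodesic connecting $x$ and $y$ is the image of an isometric embedding of the interval $[0,d_F(x,y)]$ into $(\Omega,d_F)$ sending the endpoints to $x$ and $y$. *)

theory Defs
  imports "HOL-Analysis.Analysis"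
begin

definition bdist :: "(complex ^ 'n) set \<Rightarrow> complex ^ 'n \<Rightarrow> real" where
  "bdist \<Omega> x = infdist x (frontier \<Omega>)"

(* The second conjunct is upper semi-continuity of F on \<Omega> \<times> \<complex>^n: strict sublevel sets are
   relatively open. *)
definition finsler_metric ::
    "(complex ^ 'n) set \<Rightarrow> (complex ^ 'n \<Rightarrow> complex ^ 'n \<Rightarrow> real) \<Rightarrow> bool" where
  "finsler_metric \<Omega> F \<longleftrightarrow>
     (\<forall>z\<in>\<Omega>. \<forall>X. 0 \<le> F z X) \<and>
     (\<forall>c. openin (top_of_set (\<Omega> \<times> UNIV)) {(z, X). z \<in> \<Omega> \<and> F z X < c}) \<and>
     (\<forall>z\<in>\<Omega>. \<forall>X t. F z (t *s X) = cmod t * F z X)"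

(* Piecewise C^1 in the classical sense: between consecutive break points (the elements of S) the
   curve is C^1 up to the end points, with one-sided derivatives there.  This is stricter than
   piecewise_C1_differentiable_on, which lets the derivative blow up at a break point, so that
   the integral defining the Finsler length need not exist. *)
definition piecewise_C1_curve :: "(real \<Rightarrow> complex ^ 'n) \<Rightarrow> bool" where
  "piecewise_C1_curve \<gamma> \<longleftrightarrow>
     continuous_on {0..1} \<gamma> \<and>
     (\<exists>S. finite S \<and>
        (\<forall>a b. 0 \<le> a \<and> a < b \<and> b \<le> 1 \<and> {a<..<b} \<inter> S = {} \<longrightarrow>
           (\<exists>D. continuous_on {a..b} D \<and>
                (\<forall>t\<in>{a..b}. (\<gamma> has_vector_derivative D t) (at t within {a..b})))))"

definition finsler_length ::
    "(complex ^ 'n \<Rightarrow> complex ^ 'n \<Rightarrow> real) \<Rightarrow> (real \<Rightarrow> complex ^ 'n) \<Rightarrow> real" where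
  "finsler_length F \<gamma> =
     integral {0..1} (\<lambda>t. F (\<gamma> t) (vector_derivative \<gamma> (at t within {0..1})))"

(* Only the values on \<Omega> \<times> \<Omega> matter.  The value 0 elsewhere is chosen because the locale
   Metric_space demands nonnegativity and symmetry on the whole type.  For a Finsler metric on an
   open connected \<Omega> the infimum is over a nonempty set of nonnegative reals. *)
definition finsler_dist ::
    "(complex ^ 'n) set \<Rightarrow> (complex ^ 'n \<Rightarrow> complex ^ 'n \<Rightarrow> real) \<Rightarrow>
     complex ^ 'n \<Rightarrow> complex ^ 'n \<Rightarrow> real" where
  "finsler_dist \<Omega> F x y =
     (if x \<in> \<Omega> \<and> y \<in> \<Omega> then
        Inf {finsler_length F \<gamma> | \<gamma>.
               piecewise_C1_curve \<gamma> \<and> \<gamma> ` {0..1} \<subseteq> \<Omega> \<and> \<gamma> 0 = x \<and> \<gamma> 1 = y}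
      else 0)"

(* A geodesic [x,y] is the image of such a \<sigma>.  It is represented by \<sigma> itself, which the image
   determines on {0..d(x,y)}: \<sigma> t is its only point at Finsler distance t from x. *)
definition finsler_geodesic ::
    "(complex ^ 'n) set \<Rightarrow> (complex ^ 'n \<Rightarrow> complex ^ 'n \<Rightarrow> real) \<Rightarrow>
     complex ^ 'n \<Rightarrow> complex ^ 'n \<Rightarrow> (real \<Rightarrow> complex ^ 'n) \<Rightarrow> bool" where
  "finsler_geodesic \<Omega> F x y \<sigma> \<longleftrightarrow>
     \<sigma> ` {0..finsler_dist \<Omega> F x y} \<subseteq> \<Omega> \<and>
     (\<forall>s\<in>{0..finsler_dist \<Omega> F x y}. \<forall>t\<in>{0..finsler_dist \<Omega> F x y}.
        finsler_dist \<Omega> F (\<sigma> s) (\<sigma> t) = \<bar>s - t\<bar>) \<and>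
     \<sigma> 0 = x \<and> \<sigma> (finsler_dist \<Omega> F x y) = y"

(* Supremum of the lengths of inscribed polygons; possibly infinite. *)
definition euclidean_length :: "real \<Rightarrow> real \<Rightarrow> (real \<Rightarrow> complex ^ 'n) \<Rightarrow> ennreal" where
  "euclidean_length a b \<sigma> =
     Sup {(\<Sum>i<N. ennreal (dist (\<sigma> (t i)) (\<sigma> (t (Suc i))))) | (N::nat) t.
            mono_on {..N} t \<and> t ` {..N} \<subseteq> {a..b}}"

end

theory Submission
  imports Defs
begin

text \<open>
  Let \<open>\<sigma>\<close> be a geodesic from \<open>x\<close> to \<open>y\<close> and \<open>D = d(x,y)\<close>. The lower bound on \<open>d\<close>, applied to the
  pairs \<open>(x, \<sigma> s)\<close> and \<open>(\<sigma> s, y)\<close>, bounds \<open>\<delta>(\<sigma> s)\<close> from above by a constant times both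
  \<open>\<delta>(x) exp(s/\<alpha>)\<close> and \<open>\<delta>(y) exp((D - s)/\<alpha>)\<close>. The lower bound on \<open>F\<close> makes the Euclidean speed of
  \<open>\<sigma>\<close> at most a constant times \<open>\<delta>(\<sigma> s) powr \<beta>\<close>. Integrating the smaller of the two exponentials,
  which cross where both equal \<open>E = sqrt(\<delta>(x) \<delta>(y)) exp(D/(2\<alpha>))\<close>, gives \<open>L \<le> const * E powr \<beta>\<close>. The
  lower bound on \<open>d(x,y)\<close> itself says \<open>max(\<delta>(x), \<delta>(y)) \<le> const * E\<close>. Add the two and take logarithms.
\<close>

section \<open>Integrability of the Finsler speed\<close>

text \<open>Upper semi-continuity yields measurability and, by compactness, an upper bound;
  nonnegativity is the lower bound. A bounded measurable function on a compact interval is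
  integrable.\<close>

lemma usc_nonneg_integrable_on:
  fixes h :: "real \<Rightarrow> real"
  assumes nonneg: "\<And>t. t \<in> {a..b} \<Longrightarrow> 0 \<le> h t"
    and usc: "\<And>c. openin (top_of_set {a..b}) {t \<in> {a..b}. h t < c}"
  shows "h integrable_on {a..b}"
proof -
  obtain c where c: "\<And>t. t \<in> {a..b} \<Longrightarrow> h t < c"
  proof -
    let ?U = "\<lambda>n::nat. {t \<in> {a..b}. h t < real n}"
    have "{a..b} \<subseteq> \<Union> (range ?U)"
      using reals_Archimedean2 by auto
    moreover have "\<forall>C\<in>range ?U. openin (top_of_set {a..b}) C"
      using usc by auto
    ultimately obtain \<D> where \<D>: "\<D> \<subseteq> range ?U" "finite \<D>" "{a..b} \<subseteq> \<Union>\<D>"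
      using compact_Icc[of a b] unfolding compact_eq_openin_cover by meson
    then obtain N where N: "finite N" "\<D> = ?U ` N"
      by (meson finite_subset_image)
    show ?thesis
    proof (rule that)
      fix t assume "t \<in> {a..b}"
      with \<D> N obtain n where "n \<in> N" "h t < real n" by blast
      moreover from this N have "real n \<le> real (Max N)" by simp
      ultimately show "h t < real (Max N)" by linarith
    qed
  qed
  have "h \<in> borel_measurable (lebesgue_on {a..b})"
    unfolding borel_measurable_iff_less
  proof
    fix c
    obtain T where "open T" "{t \<in> {a..b}. h t < c} = {a..b} \<inter> T"
      using usc[of c] unfolding openin_open by blast
    moreover from \<open>open T\<close> have "T \<in> sets lebesgue" by simp
    ultimately show "{t \<in> space (lebesgue_on {a..b}). h t < c} \<in> sets (lebesgue_on {a..b})"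
      by (simp add: sets_restrict_space)
  qed
  moreover have "(\<lambda>_. c) integrable_on {a..b}" by (rule integrable_const_ivl)
  ultimately show ?thesis
    by (rule measurable_bounded_by_integrable_imp_integrable)
       (use nonneg c in \<open>auto simp: less_imp_le\<close>)
qed

lemma finsler_metric_nonneg:
  assumes "finsler_metric \<Omega> F" "z \<in> \<Omega>"
  shows "0 \<le> F z X"
  using assms by (simp add: finsler_metric_def)

lemma finsler_metric_zero:
  assumes "finsler_metric \<Omega> F" "z \<in> \<Omega>"
  shows "F z 0 = 0"
  using assms unfolding finsler_metric_def
  by (metis norm_zero mult_zero_left vector_smult_lzero)

lemma finsler_metric_scaleR:
  assumes "finsler_metric \<Omega> F" "z \<in> \<Omega>" "0 \<le> u"
  shows "F z (u *\<^sub>R X) = u * F z X"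
proof -
  have "u *\<^sub>R X = complex_of_real u *s X"
    by (simp add: vec_eq_iff scaleR_conv_of_real[where 'a=complex])
  then show ?thesis
    using assms unfolding finsler_metric_def by auto
qed

text \<open>The relatively open sublevel set is pulled back along the continuous map given by
  \<open>\<gamma>\<close> and \<open>D\<close>. Later \<open>D\<close> is the continuous extension
  of the velocity over one smooth piece.\<close>

lemma finsler_metric_usc_comp:
  fixes \<gamma> D :: "real \<Rightarrow> complex ^ 'n"
  assumes F: "finsler_metric \<Omega> F"
    and "continuous_on A \<gamma>" "continuous_on A D" "\<gamma> ` A \<subseteq> \<Omega>"
  shows "openin (top_of_set A) {t \<in> A. F (\<gamma> t) (D t) < c}"
proof -
  let ?T = "{(z, X). z \<in> \<Omega> \<and> F z X < c}"
  have "continuous_on A (\<lambda>t. (\<gamma> t, D t))"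
    using assms by (intro continuous_on_Pair)
  moreover have "(\<lambda>t. (\<gamma> t, D t)) \<in> A \<rightarrow> \<Omega> \<times> UNIV" using assms by auto
  moreover have "openin (top_of_set (\<Omega> \<times> UNIV)) ?T"
    using F by (simp add: finsler_metric_def)
  ultimately have "openin (top_of_set A) (A \<inter> (\<lambda>t. (\<gamma> t, D t)) -` ?T)"
    by (rule continuous_openin_preimage)
  moreover have "A \<inter> (\<lambda>t. (\<gamma> t, D t)) -` ?T = {t \<in> A. F (\<gamma> t) (D t) < c}"
    using assms by auto
  ultimately show ?thesis by simp
qed

text \<open>At a break point \<open>vector_derivative\<close> need not be meaningful, so the
  velocity is controlled only off a finite set. Inside each smooth piece it agrees with a function
  that is continuous up to the end points.\<close>

lemma piecewise_C1_curveE: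
  assumes "piecewise_C1_curve \<gamma>"
  obtains S where "finite S"
    and "\<And>t. t \<in> {0..1} - S \<Longrightarrow>
           (\<gamma> has_vector_derivative vector_derivative \<gamma> (at t within {0..1})) (at t)"
    and "\<And>a b. 0 \<le> a \<Longrightarrow> a < b \<Longrightarrow> b \<le> 1 \<Longrightarrow> {a<..<b} \<inter> S = {} \<Longrightarrow>
           \<exists>D. continuous_on {a..b} D \<and>
               (\<forall>t\<in>{a<..<b}. vector_derivative \<gamma> (at t within {0..1}) = D t)"
proof -
  obtain S where S: "finite S" and D: "\<And>a b. 0 \<le> a \<Longrightarrow> a < b \<Longrightarrow> b \<le> 1 \<Longrightarrow> {a<..<b} \<inter> S = {} \<Longrightarrow>
      \<exists>D. continuous_on {a..b} D \<and>
          (\<forall>t\<in>{a..b}. (\<gamma> has_vector_derivative D t) (at t within {a..b}))"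
    using assms unfolding piecewise_C1_curve_def by blast
  have piece: "\<exists>D. continuous_on {a..b} D \<and>
      (\<forall>t\<in>{a<..<b}. (\<gamma> has_vector_derivative D t) (at t) \<and>
          vector_derivative \<gamma> (at t within {0..1}) = D t)"
    if ab: "0 \<le> a" "a < b" "b \<le> 1" "{a<..<b} \<inter> S = {}" for a b
  proof -
    obtain D where D: "continuous_on {a..b} D"
        "\<And>t. t \<in> {a..b} \<Longrightarrow> (\<gamma> has_vector_derivative D t) (at t within {a..b})"
      using D[OF ab] by blast
    have "(\<gamma> has_vector_derivative D t) (at t) \<and>
        vector_derivative \<gamma> (at t within {0..1}) = D t" if t: "t \<in> {a<..<b}" for t
    proof -
      have "(\<gamma> has_vector_derivative D t) (at t)"
        using D(2)[of t] t by (simp add: at_within_Icc_at)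
      moreover have "at t within {0..1} = at t"
        using t ab by (intro at_within_Icc_at) auto
      ultimately show ?thesis by (simp add: vector_derivative_at)
    qed
    with D(1) show ?thesis by blast
  qed
  show ?thesis
  proof (rule that)
    \<comment> \<open>With 0 and 1 among the exceptional parameters, every other parameter is
      interior, and there the derivative within \<open>{0..1}\<close> is the two-sided one.\<close>
    show "finite (insert 0 (insert 1 S))" using S by simp
  next
    fix t :: real assume t: "t \<in> {0..1} - insert 0 (insert 1 S)"
    have "open ({0<..<1} - S)"
      using S by (intro open_Diff finite_imp_closed open_greaterThanLessThan)
    moreover have "t \<in> {0<..<1} - S" using t by auto
    ultimately obtain e where e: "e > 0" "cball t e \<subseteq> {0<..<1} - S"
      by (meson open_contains_cball)
    then have "{t - e..t + e} \<subseteq> {0<..<1} - S"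
      by (simp add: cball_eq_atLeastAtMost)
    moreover have "{t - e, t + e} \<union> {t - e<..<t + e} \<subseteq> {t - e..t + e}"
      using e(1) by auto
    ultimately have "t - e \<in> {0<..<1}" "t + e \<in> {0<..<1}" "{t - e<..<t + e} \<inter> S = {}"
      by blast+
    then show "(\<gamma> has_vector_derivative vector_derivative \<gamma> (at t within {0..1})) (at t)"
      using piece[of "t - e" "t + e"] e(1) by fastforce
  next
    fix a b :: real
    assume "0 \<le> a" "a < b" "b \<le> 1" "{a<..<b} \<inter> insert 0 (insert 1 S) = {}"
    then show "\<exists>D. continuous_on {a..b} D \<and>
        (\<forall>t\<in>{a<..<b}. vector_derivative \<gamma> (at t within {0..1}) = D t)"
      using piece[of a b] by blast
  qed
qed

text \<open>Integrability is a local matter: near a parameter \<open>x\<close> the only possible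
  break point is \<open>x\<close> itself, so a small interval around \<open>x\<close> splits there
  into two smooth pieces. This avoids ordering the break points.\<close>

lemma finsler_speed_integrable_on:
  assumes F: "finsler_metric \<Omega> F"
    and \<gamma>: "piecewise_C1_curve \<gamma>" "\<gamma> ` {0..1} \<subseteq> \<Omega>"
  shows "(\<lambda>t. F (\<gamma> t) (vector_derivative \<gamma> (at t within {0..1}))) integrable_on {0..1}"
    (is "?f integrable_on _")
proof -
  obtain S where S: "finite S" and D: "\<And>a b. 0 \<le> a \<Longrightarrow> a < b \<Longrightarrow> b \<le> 1 \<Longrightarrow> {a<..<b} \<inter> S = {} \<Longrightarrow>
      \<exists>D. continuous_on {a..b} D \<and>
          (\<forall>t\<in>{a<..<b}. vector_derivative \<gamma> (at t within {0..1}) = D t)"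
    using piecewise_C1_curveE[OF \<gamma>(1)] by metis
  have piece: "?f integrable_on {a..b}" if ab: "0 \<le> a" "b \<le> 1" "{a<..<b} \<inter> S = {}" for a b
  proof (cases "a < b")
    case True
    then obtain D where D: "continuous_on {a..b} D"
        "\<And>t. t \<in> {a<..<b} \<Longrightarrow> vector_derivative \<gamma> (at t within {0..1}) = D t"
      using D[OF ab(1) _ ab(2,3)] by blast
    have "continuous_on {a..b} \<gamma>"
      using \<gamma>(1) ab continuous_on_subset unfolding piecewise_C1_curve_def by fastforce
    moreover have im: "\<gamma> ` {a..b} \<subseteq> \<Omega>" using \<gamma>(2) ab by fastforce
    ultimately have "(\<lambda>t. F (\<gamma> t) (D t)) integrable_on {a..b}"
      using D(1)
      by (intro usc_nonneg_integrable_on finsler_metric_usc_comp[OF F])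
         (auto simp: image_subset_iff intro: finsler_metric_nonneg[OF F])
    \<comment> \<open>At \<open>a\<close> and \<open>b\<close> the velocity may differ from
      \<open>D\<close>; two points do not affect integrability.\<close>
    moreover have "?f t = F (\<gamma> t) (D t)" if "t \<in> {a..b} - {a, b}" for t
      using D(2)[of t] that by simp
    ultimately show ?thesis
      by (intro integrable_spike_finite
          [of "{a, b}" "{a..b}" ?f "\<lambda>t. F (\<gamma> t) (D t)"]) auto
  next
    case False
    then show ?thesis using integrable_on_refl[of ?f b] by (cases "a = b") auto
  qed
  have "?f integrable_on cbox 0 1"
  proof (rule integrable_on_little_subintervals, intro ballI)
    fix x :: real assume "x \<in> cbox 0 1"
    obtain d where d: "d > 0" "\<And>s. s \<in> S \<Longrightarrow> s \<noteq> x \<Longrightarrow> d \<le> dist x s"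
      using finite_set_avoid[OF S] by meson
    have "?f integrable_on cbox u v"
      if uv: "x \<in> cbox u v" "cbox u v \<subseteq> ball x d" "cbox u v \<subseteq> cbox 0 1" for u v
    proof -
      have x: "u \<le> x" "x \<le> v" "0 \<le> u" "v \<le> 1" using uv(1,3) by auto
      have "s \<notin> S" if "s \<in> {u..v}" "s \<noteq> x" for s
        using d(2)[of s] uv(2) that by (fastforce simp: dist_commute)
      then have "{u<..<x} \<inter> S = {}" "{x<..<v} \<inter> S = {}" using x by auto
      then have "?f integrable_on {u..x}" "?f integrable_on {x..v}"
        using x by (auto intro!: piece)
      then show ?thesis
        using Henstock_Kurzweil_Integration.integrable_combine[OF x(1,2)] by simp
    qed
    with d(1) show "\<exists>d>0. \<forall>u v. x \<in> cbox u v \<and> cbox u v \<subseteq> ball x d \<and> cbox u v \<subseteq> cbox 0 1 \<longrightarrow>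
        ?f integrable_on cbox u v" by blast
  qed
  then show ?thesis by simp
qed

section \<open>Finsler length, almost minimal curves and initial segments\<close>

lemma finsler_length_nonneg:
  assumes "finsler_metric \<Omega> F" "piecewise_C1_curve \<gamma>" "\<gamma> ` {0..1} \<subseteq> \<Omega>"
  shows "0 \<le> finsler_length F \<gamma>"
  unfolding finsler_length_def using assms
  by (intro Henstock_Kurzweil_Integration.integral_nonneg finsler_speed_integrable_on)
     (auto simp: image_subset_iff intro: finsler_metric_nonneg)

lemma finsler_dist_le_length:
  assumes "finsler_metric \<Omega> F" "piecewise_C1_curve \<gamma>" "\<gamma> ` {0..1} \<subseteq> \<Omega>" "\<gamma> 0 = x" "\<gamma> 1 = y"
  shows "finsler_dist \<Omega> F x y \<le> finsler_length F \<gamma>"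
proof -
  have "x \<in> \<Omega>" "y \<in> \<Omega>" using assms by auto
  then show ?thesis
    unfolding finsler_dist_def using assms
    by (auto intro!: cInf_lower bdd_belowI[of _ 0] finsler_length_nonneg)
qed

lemma piecewise_C1_curve_polynomial_function:
  assumes "polynomial_function g"
  shows "piecewise_C1_curve g"
proof -
  obtain g' where "polynomial_function g'" "\<And>t. (g has_vector_derivative g' t) (at t)"
    using has_vector_derivative_polynomial_function[OF assms] by auto
  then show ?thesis
    unfolding piecewise_C1_curve_def using assms
    by (intro conjI exI[of _ "{}"] allI impI exI[of _ g'])
       (auto intro: has_vector_derivative_at_within continuous_on_polymonial_function)
qed

text \<open>Two points of an open connected set are joined by a polynomial path, which is a smooth
  competitor. Hence the infimum is over a nonempty set and is approximated by its members.\<close>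

lemma finsler_dist_approx:
  assumes "open \<Omega>" "connected \<Omega>" "x \<in> \<Omega>" "y \<in> \<Omega>" "finsler_dist \<Omega> F x y < r"
  obtains \<gamma> where "piecewise_C1_curve \<gamma>" "\<gamma> ` {0..1} \<subseteq> \<Omega>" "\<gamma> 0 = x" "\<gamma> 1 = y"
    "finsler_length F \<gamma> < r"
proof -
  let ?A = "{finsler_length F \<gamma> | \<gamma>.
      piecewise_C1_curve \<gamma> \<and> \<gamma> ` {0..1} \<subseteq> \<Omega> \<and> \<gamma> 0 = x \<and> \<gamma> 1 = y}"
  obtain g where "polynomial_function g" "path_image g \<subseteq> \<Omega>" "pathstart g = x" "pathfinish g = y"
    using connected_open_polynomial_connected[OF assms(1-4)] by auto
  then have "finsler_length F g \<in> ?A"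
    using piecewise_C1_curve_polynomial_function
    unfolding path_image_def pathstart_def pathfinish_def by blast
  then have "?A \<noteq> {}" by blast
  moreover have "Inf ?A < r" using assms by (simp add: finsler_dist_def)
  ultimately obtain l where "l \<in> ?A" "l < r"
    by (meson cInf_lessD)
  then show ?thesis using that by blast
qed

text \<open>Supplies a competitor for the distance from the start of \<open>\<gamma>\<close> to an
  intermediate point. A break point \<open>s\<close> moves to \<open>s / u\<close>.\<close>

lemma piecewise_C1_curve_initial_segment:
  fixes \<gamma> :: "real \<Rightarrow> complex ^ 'n"
  assumes \<gamma>: "piecewise_C1_curve \<gamma>" and u: "0 < u" "u \<le> 1"
  shows "piecewise_C1_curve (\<lambda>t. \<gamma> (u * t))"
proof -
  have img: "(*) u ` {a..b} = {u * a..u * b}" for a b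
    using u by (simp add: image_mult_atLeastAtMost)
  obtain S where S: "finite S" and D: "\<And>a b. 0 \<le> a \<Longrightarrow> a < b \<Longrightarrow> b \<le> 1 \<Longrightarrow> {a<..<b} \<inter> S = {} \<Longrightarrow>
      \<exists>D. continuous_on {a..b} D \<and>
          (\<forall>t\<in>{a..b}. (\<gamma> has_vector_derivative D t) (at t within {a..b}))"
    using \<gamma> unfolding piecewise_C1_curve_def by blast
  have "continuous_on {0..1} (\<lambda>t. \<gamma> (u * t))"
  proof (rule continuous_on_compose2[of "{0..1}" \<gamma>])
    show "continuous_on {0..1} \<gamma>" using \<gamma> by (simp add: piecewise_C1_curve_def)
  qed (use u in \<open>auto intro!: continuous_intros mult_le_one\<close>)
  moreover have "\<exists>D. continuous_on {a..b} D \<and>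
      (\<forall>t\<in>{a..b}. ((\<lambda>t. \<gamma> (u * t)) has_vector_derivative D t) (at t within {a..b}))"
    if ab: "0 \<le> a" "a < b" "b \<le> 1" "{a<..<b} \<inter> (\<lambda>s. s / u) ` S = {}" for a b
  proof -
    have "{u * a<..<u * b} \<inter> S = {}"
    proof (intro equals0I, elim IntE)
      fix s assume "s \<in> {u * a<..<u * b}" "s \<in> S"
      then have "s / u \<in> {a<..<b} \<inter> (\<lambda>s. s / u) ` S"
        using u by (auto simp: field_simps)
      with ab(4) show False by blast
    qed
    moreover have "0 \<le> u * a" "u * a < u * b" "u * b \<le> 1"
      using ab u by (auto intro: mult_le_one)
    ultimately obtain D where D: "continuous_on {u * a..u * b} D"
        "\<And>t. t \<in> {u * a..u * b} \<Longrightarrow> (\<gamma> has_vector_derivative D t) (at t within {u * a..u * b})"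
      using D by blast
    have "continuous_on {a..b} (\<lambda>t. u *\<^sub>R D (u * t))"
      using D(1) img[of a b]
      by (intro continuous_intros continuous_on_compose2[OF D(1)]) auto
    moreover have "((\<lambda>t. \<gamma> (u * t)) has_vector_derivative u *\<^sub>R D (u * t)) (at t within {a..b})"
      if "t \<in> {a..b}" for t
    proof -
      have "((*) u has_vector_derivative u) (at t within {a..b})"
        by (auto intro!: derivative_eq_intros simp: has_vector_derivative_def)
      moreover have "(\<gamma> has_vector_derivative D (u * t)) (at (u * t) within (*) u ` {a..b})"
        unfolding img using that u by (intro D) auto
      ultimately show ?thesis
        using vector_diff_chain_within by (fastforce simp: o_def)
    qed
    ultimately show ?thesis by blast
  qed
  ultimately show ?thesis
    unfolding piecewise_C1_curve_def using S
    by (intro conjI exI[of _ "(\<lambda>s. s / u) ` S"]) auto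
qed

text \<open>By homogeneity of \<open>F\<close> and the substitution \<open>u * t\<close>, the left
  side is the integral of the speed of \<open>\<gamma>\<close> over \<open>{0..u}\<close>; the speed
  on the rest is nonnegative.\<close>

lemma finsler_length_initial_segment_le:
  assumes F: "finsler_metric \<Omega> F"
    and \<gamma>: "piecewise_C1_curve \<gamma>" "\<gamma> ` {0..1} \<subseteq> \<Omega>" and u: "0 < u" "u \<le> 1"
  shows "finsler_length F (\<lambda>t. \<gamma> (u * t)) \<le> finsler_length F \<gamma>"
proof -
  define f where "f t = F (\<gamma> t) (vector_derivative \<gamma> (at t within {0..1}))" for t
  have f: "f integrable_on {0..1}"
    unfolding f_def by (rule finsler_speed_integrable_on[OF F \<gamma>])
  then have fu: "f integrable_on {0..u}"
    using u by (auto elim: integrable_on_subinterval)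
  obtain S where S: "finite S" and D: "\<And>t. t \<in> {0..1} - S \<Longrightarrow>
      (\<gamma> has_vector_derivative vector_derivative \<gamma> (at t within {0..1})) (at t)"
    using piecewise_C1_curveE[OF \<gamma>(1)] by metis
  let ?g = "\<lambda>t. F (\<gamma> (u * t)) (vector_derivative (\<lambda>t. \<gamma> (u * t)) (at t within {0..1}))"
  have "((\<lambda>t. f (u * t)) has_integral (1 / u) * integral {0..u} f) {0..1}"
    using has_integral_stretch_real[OF integrable_integral[OF fu], of u] u by simp
  from has_integral_mult_right[OF this, of u]
  have "((\<lambda>t. u * f (u * t)) has_integral integral {0..u} f) {0..1}"
    using u by simp
  moreover have "?g t = u * f (u * t)" if t: "t \<in> {0..1} - ({0, 1} \<union> (\<lambda>s. s / u) ` S)" for t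
  proof -
    have ut: "u * t \<in> {0..1} - S"
    proof -
      have "u * t \<notin> S" using t u by force
      moreover have "u * t \<le> 1" "0 \<le> u * t" using t u by (auto intro: mult_le_one)
      ultimately show ?thesis by simp
    qed
    have "((*) u has_vector_derivative u) (at t)"
      by (auto intro!: derivative_eq_intros simp: has_vector_derivative_def)
    from vector_diff_chain_at[OF this D[OF ut]]
    have "((\<lambda>t. \<gamma> (u * t)) has_vector_derivative
        u *\<^sub>R vector_derivative \<gamma> (at (u * t) within {0..1})) (at t)"
      by (simp add: o_def)
    moreover have "at t within {0..1} = at t" using t by (intro at_within_Icc_at) auto
    ultimately have "vector_derivative (\<lambda>t. \<gamma> (u * t)) (at t within {0..1}) =
        u *\<^sub>R vector_derivative \<gamma> (at (u * t) within {0..1})"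
      by (simp add: vector_derivative_at)
    moreover have "\<gamma> (u * t) \<in> \<Omega>" using ut \<gamma>(2) by blast
    ultimately show ?thesis
      using F u by (simp add: finsler_metric_scaleR f_def)
  qed
  ultimately have "(?g has_integral integral {0..u} f) {0..1}"
    using S by (intro has_integral_spike_finite
        [of "{0, 1} \<union> (\<lambda>s. s / u) ` S" _ ?g "\<lambda>t. u * f (u * t)"]) auto
  then have "finsler_length F (\<lambda>t. \<gamma> (u * t)) = integral {0..u} f"
    by (simp add: finsler_length_def integral_unique)
  also have "\<dots> \<le> integral {0..1} f"
    using F \<gamma>(2) u f fu
    by (intro integral_subset_le) (auto simp: f_def finsler_metric_def)
  finally show ?thesis by (simp add: finsler_length_def f_def[abs_def])
qed

section \<open>Euclidean distance against Finsler distance\<close>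

text \<open>Integrate the velocity and bound its norm pointwise. The bound is asked for at positive
  parameters only, because it will come from initial segments, which have positive length in the
  parameter.\<close>

lemma norm_diff_le_finsler_length:
  assumes F: "finsler_metric \<Omega> F"
    and \<gamma>: "piecewise_C1_curve \<gamma>" "\<gamma> ` {0..1} \<subseteq> \<Omega>"
    and bound: "\<And>t X. t \<in> {0<..1} \<Longrightarrow> norm X \<le> K * F (\<gamma> t) X"
  shows "norm (\<gamma> 1 - \<gamma> 0) \<le> K * finsler_length F \<gamma>"
proof -
  let ?d = "\<lambda>t. vector_derivative \<gamma> (at t within {0..1})"
  obtain S where S: "finite S" and D: "\<And>t. t \<in> {0..1} - S \<Longrightarrow>
      (\<gamma> has_vector_derivative ?d t) (at t)"
    using piecewise_C1_curveE[OF \<gamma>(1)] by metis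
  have "(?d has_integral (\<gamma> 1 - \<gamma> 0)) {0..1}"
    by (rule fundamental_theorem_of_calculus_strong[OF S])
       (use D \<gamma>(1) in \<open>auto simp: piecewise_C1_curve_def\<close>)
  \<comment> \<open>Both integrands are set to 0 at the parameter 0, where \<open>bound\<close> says
    nothing; the integrals stay the same.\<close>
  then have 1: "((\<lambda>t. if t = 0 then 0 else ?d t) has_integral (\<gamma> 1 - \<gamma> 0)) {0..1}"
    by (rule has_integral_spike_finite[of "{0}", rotated 2]) auto
  have "((\<lambda>t. K * F (\<gamma> t) (?d t)) has_integral K * finsler_length F \<gamma>) {0..1}"
    unfolding finsler_length_def
    by (intro has_integral_mult_right integrable_integral finsler_speed_integrable_on[OF F \<gamma>])
  then have 2: "((\<lambda>t. if t = 0 then 0 else K * F (\<gamma> t) (?d t)) has_integral K * finsler_length F \<gamma>) {0..1}"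
    by (rule has_integral_spike_finite[of "{0}", rotated 2]) auto
  have "norm (integral {0..1} (\<lambda>t. if t = 0 then 0 else ?d t)) \<le>
      integral {0..1} (\<lambda>t. if t = 0 then 0 else K * F (\<gamma> t) (?d t))"
    by (intro Henstock_Kurzweil_Integration.integral_norm_bound_integral)
       (use 1 2 in \<open>auto intro: bound has_integral_integrable\<close>)
  then show ?thesis using 1 2 by (simp add: integral_unique)
qed

lemma bdist_pos:
  assumes "open \<Omega>" "bounded \<Omega>" "z \<in> \<Omega>"
  shows "0 < bdist \<Omega> z"
proof -
  \<comment> \<open>\<open>infdist\<close> to the empty set is 0 by convention, so the frontier must
    have a point: \<open>\<Omega>\<close> is neither empty nor, being bounded, the whole
    space.\<close>
  have "frontier \<Omega> \<noteq> {}"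
    using assms frontier_eq_empty[of \<Omega>] not_bounded_UNIV by blast
  moreover have "z \<notin> frontier \<Omega>"
    using assms by (simp add: frontier_def interior_open)
  ultimately show ?thesis
    unfolding bdist_def by (intro infdist_pos_not_in_closed) auto
qed

text \<open>Along an almost minimal curve from \<open>p\<close> to \<open>q\<close> every point is at Finsler distance at most 2
  from \<open>p\<close>, so there the boundary distance exceeds that of \<open>p\<close> by a bounded factor only.\<close>
lemma dist_le_finsler_dist:
  fixes \<Omega> :: "(complex ^ 'n) set"
  assumes \<Omega>: "open \<Omega>" "connected \<Omega>" "bounded \<Omega>"
    and F: "finsler_metric \<Omega> F"
    and pos: "C2 > 0" "\<beta> \<ge> 0"
    and comparable: "\<And>z. z \<in> \<Omega> \<Longrightarrow> finsler_dist \<Omega> F p z \<le> 2 \<Longrightarrow> bdist \<Omega> z \<le> R * bdist \<Omega> p"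
    and metric_lower: "\<And>z X. z \<in> \<Omega> \<Longrightarrow> X \<noteq> 0 \<Longrightarrow> C2 * norm X / bdist \<Omega> z powr \<beta> \<le> F z X"
    and pq: "p \<in> \<Omega>" "q \<in> \<Omega>" "finsler_dist \<Omega> F p q \<le> 1"
  shows "dist p q \<le> (R * bdist \<Omega> p) powr \<beta> / C2 * finsler_dist \<Omega> F p q"
proof -
  define K where "K = (R * bdist \<Omega> p) powr \<beta> / C2"
  have K: "0 \<le> K" using pos by (simp add: K_def)
  \<comment> \<open>The infimum need not be attained, hence the slack \<open>e\<close>. With
    \<open>e \<le> 1\<close> the chosen curve has length below 2, as \<open>comparable\<close>
    demands; at the end \<open>e\<close> tends to 0.\<close>
  have le: "dist p q \<le> K * (finsler_dist \<Omega> F p q + e)" if e: "0 < e" "e \<le> 1" for e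
  proof -
    obtain \<gamma> where \<gamma>: "piecewise_C1_curve \<gamma>" "\<gamma> ` {0..1} \<subseteq> \<Omega>" "\<gamma> 0 = p" "\<gamma> 1 = q"
      and len: "finsler_length F \<gamma> < finsler_dist \<Omega> F p q + e"
      using finsler_dist_approx[OF \<Omega>(1,2) pq(1,2), of F "finsler_dist \<Omega> F p q + e"] e by auto
    have "norm X \<le> K * F (\<gamma> u) X" if u: "u \<in> {0<..1}" for u X
    proof -
      have \<gamma>u: "\<gamma> u \<in> \<Omega>" using \<gamma>(2) u by auto
      have "(\<lambda>t. \<gamma> (u * t)) ` {0..1} \<subseteq> \<Omega>"
        using \<gamma>(2) u by (auto simp: image_subset_iff mult_le_one)
      then have "finsler_dist \<Omega> F p (\<gamma> u) \<le> finsler_length F (\<lambda>t. \<gamma> (u * t))"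
        using u \<gamma> by (intro finsler_dist_le_length[OF F] piecewise_C1_curve_initial_segment) auto
      also have "\<dots> \<le> finsler_length F \<gamma>"
        using finsler_length_initial_segment_le[OF F \<gamma>(1,2)] u by simp
      also have "\<dots> \<le> 2" using len e pq(3) by simp
      finally have "bdist \<Omega> (\<gamma> u) \<le> R * bdist \<Omega> p" by (rule comparable[OF \<gamma>u])
      moreover have \<gamma>u_pos: "0 < bdist \<Omega> (\<gamma> u)" by (rule bdist_pos[OF \<Omega>(1,3) \<gamma>u])
      ultimately have "bdist \<Omega> (\<gamma> u) powr \<beta> / C2 \<le> K"
        unfolding K_def using pos by (intro divide_right_mono powr_mono2) auto
      then have "bdist \<Omega> (\<gamma> u) powr \<beta> / C2 * F (\<gamma> u) X \<le> K * F (\<gamma> u) X"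
        by (intro mult_right_mono finsler_metric_nonneg[OF F \<gamma>u])
      moreover have "norm X \<le> bdist \<Omega> (\<gamma> u) powr \<beta> / C2 * F (\<gamma> u) X"
      proof (cases "X = 0")
        case True
        then show ?thesis using finsler_metric_zero[OF F \<gamma>u] by simp
      next
        case False
        then show ?thesis
          using metric_lower[OF \<gamma>u False] pos \<gamma>u_pos by (simp add: field_simps)
      qed
      ultimately show ?thesis by linarith
    qed
    then have "norm (\<gamma> 1 - \<gamma> 0) \<le> K * finsler_length F \<gamma>"
      by (rule norm_diff_le_finsler_length[OF F \<gamma>(1,2)])
    also have "\<dots> \<le> K * (finsler_dist \<Omega> F p q + e)"
      using len K by (intro mult_left_mono) auto
    finally show ?thesis by (simp add: \<gamma> dist_norm norm_minus_commute)
  qed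
  have "((\<lambda>e. K * (finsler_dist \<Omega> F p q + e)) \<longlongrightarrow> K * (finsler_dist \<Omega> F p q + 0)) (at_right 0)"
    by (intro tendsto_intros)
  moreover have "eventually (\<lambda>e. dist p q \<le> K * (finsler_dist \<Omega> F p q + e)) (at_right 0)"
    unfolding eventually_at_right_field using le by (intro exI[of _ 1]) auto
  ultimately have "dist p q \<le> K * (finsler_dist \<Omega> F p q + 0)"
    by (intro tendsto_lowerbound[of "\<lambda>e. K * (finsler_dist \<Omega> F p q + e)" _ "at_right 0"]) auto
  then show ?thesis by (simp add: K_def)
qed

section \<open>Euclidean length of a curve with exponentially bounded speed\<close>

text \<open>Cut the interval into steps of length at most 1, starting from the right: the increments
  of \<open>f\<close> telescope while the distances obey the triangle inequality.\<close>

lemma dist_le_diff_local_to_global: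
  fixes f :: "real \<Rightarrow> real" and \<sigma> :: "real \<Rightarrow> 'a::metric_space"
  assumes loc: "\<And>s t. a \<le> s \<Longrightarrow> s \<le> t \<Longrightarrow> t \<le> b \<Longrightarrow> t - s \<le> 1 \<Longrightarrow> dist (\<sigma> s) (\<sigma> t) \<le> f t - f s"
    and st: "a \<le> s" "s \<le> t" "t \<le> b"
  shows "dist (\<sigma> s) (\<sigma> t) \<le> f t - f s"
proof -
  have "dist (\<sigma> s) (\<sigma> t) \<le> f t - f s" if "t - s \<le> real n" "s \<le> t" "t \<le> b" for n t
    using that
  proof (induction n arbitrary: t)
    case 0
    then show ?case using loc[of s t] st by simp
  next
    case (Suc n)
    define r where "r = max s (t - 1)"
    have "dist (\<sigma> s) (\<sigma> r) \<le> f r - f s"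
      using Suc.prems by (intro Suc.IH) (auto simp: r_def)
    moreover have "dist (\<sigma> r) (\<sigma> t) \<le> f t - f r"
      using Suc.prems st(1) by (intro loc) (auto simp: r_def)
    ultimately show ?case using dist_triangle[of "\<sigma> s" "\<sigma> t" "\<sigma> r"] by linarith
  qed
  moreover obtain n where "t - s \<le> real n" using real_arch_simple by blast
  ultimately show ?thesis using st by blast
qed

text \<open>Along an inscribed polygon the increments of \<open>f\<close> telescope to a single one,
  which \<open>V\<close> bounds.\<close>

lemma euclidean_length_le:
  assumes "\<And>s t. a \<le> s \<Longrightarrow> s \<le> t \<Longrightarrow> t \<le> b \<Longrightarrow> dist (\<sigma> s) (\<sigma> t) \<le> f t - f s"
    and "\<And>s t. a \<le> s \<Longrightarrow> s \<le> t \<Longrightarrow> t \<le> b \<Longrightarrow> f t - f s \<le> V"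
  shows "euclidean_length a b \<sigma> \<le> ennreal V"
  unfolding euclidean_length_def
proof (rule Sup_least, clarify)
  fix N :: nat and t assume t: "mono_on {..N} t" "t ` {..N} \<subseteq> {a..b}"
  have mem: "a \<le> t i" "t i \<le> b" if "i \<le> N" for i using t(2) that by auto
  have mono: "t i \<le> t j" if "i \<le> j" "j \<le> N" for i j
    using mono_onD[OF t(1)] that by auto
  have "(\<Sum>i<N. ennreal (dist (\<sigma> (t i)) (\<sigma> (t (Suc i))))) =
      ennreal (\<Sum>i<N. dist (\<sigma> (t i)) (\<sigma> (t (Suc i))))"
    by (simp add: sum_ennreal)
  also have "\<dots> \<le> ennreal (\<Sum>i<N. f (t (Suc i)) - f (t i))"
    using mem mono by (intro ennreal_leI sum_mono assms(1)) auto
  also have "\<dots> = ennreal (f (t N) - f (t 0))"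
    by (simp add: sum_lessThan_telescope[of "\<lambda>i. f (t i)"])
  also have "\<dots> \<le> ennreal V"
    using mem mono by (intro ennreal_leI assms(2)) auto
  finally show "(\<Sum>i<N. ennreal (dist (\<sigma> (t i)) (\<sigma> (t (Suc i))))) \<le> ennreal V" .
qed

text \<open>The speed is at most \<open>A * exp (b * s)\<close> and at most
  \<open>B * exp (- b * s)\<close>; the first bound is integrated up to \<open>m\<close>, the second
  from \<open>m\<close> on. The switching point \<open>m\<close> is arbitrary and may lie outside
  \<open>{0..D}\<close>.\<close>

lemma euclidean_length_le_two_sided_exp:
  fixes \<sigma> :: "real \<Rightarrow> complex ^ 'n"
  assumes b: "b > 0" and nonneg: "A \<ge> 0" "B \<ge> 0"
    and fwd: "\<And>s t. 0 \<le> s \<Longrightarrow> s \<le> t \<Longrightarrow> t \<le> D \<Longrightarrow> t - s \<le> 1 \<Longrightarrow>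
      dist (\<sigma> s) (\<sigma> t) \<le> A * exp (b * s) * (t - s)"
    and bwd: "\<And>s t. 0 \<le> s \<Longrightarrow> s \<le> t \<Longrightarrow> t \<le> D \<Longrightarrow> t - s \<le> 1 \<Longrightarrow>
      dist (\<sigma> s) (\<sigma> t) \<le> B * exp (- b * t) * (t - s)"
  shows "euclidean_length 0 D \<sigma> \<le> ennreal ((A * exp (b * m) + B * exp (- b * m)) / b)"
proof -
  \<comment> \<open>A continuous primitive of the bound that switches at \<open>m\<close>: left of
    \<open>m\<close> only the first term varies, right of \<open>m\<close> only the second.\<close>
  define f where "f t = A / b * exp (b * min t m) - B / b * exp (- b * max t m)" for t
  have fwd': "dist (\<sigma> s) (\<sigma> t) \<le> A / b * exp (b * t) - A / b * exp (b * s)"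
    if "0 \<le> s" "s \<le> t" "t \<le> D" for s t
  proof (rule dist_le_diff_local_to_global[of 0 D _ "\<lambda>t. A / b * exp (b * t)"])
    fix s t :: real assume st: "0 \<le> s" "s \<le> t" "t \<le> D" "t - s \<le> 1"
    \<comment> \<open>The exponential at the left end, where it is smallest, times the step length
      is at most its integral over the step.\<close>
    have "1 + b * (t - s) \<le> exp (b * (t - s))" by (rule exp_ge_add_one_self)
    then have "exp (b * s) * (1 + b * (t - s)) \<le> exp (b * s) * exp (b * (t - s))"
      by (intro mult_left_mono) auto
    also have "\<dots> = exp (b * t)" by (simp add: exp_add[symmetric] algebra_simps)
    finally have "A / b * (exp (b * s) * (b * (t - s))) \<le> A / b * (exp (b * t) - exp (b * s))"
      using b nonneg by (intro mult_left_mono) (auto simp: algebra_simps)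
    with fwd[OF st] b show "dist (\<sigma> s) (\<sigma> t) \<le> A / b * exp (b * t) - A / b * exp (b * s)"
      by (simp add: algebra_simps)
  qed (use that in auto)
  have bwd': "dist (\<sigma> s) (\<sigma> t) \<le> - (B / b * exp (- b * t)) - - (B / b * exp (- b * s))"
    if "0 \<le> s" "s \<le> t" "t \<le> D" for s t
  proof (rule dist_le_diff_local_to_global[of 0 D _ "\<lambda>t. - (B / b * exp (- b * t))"])
    fix s t :: real assume st: "0 \<le> s" "s \<le> t" "t \<le> D" "t - s \<le> 1"
    have "1 + b * (t - s) \<le> exp (b * (t - s))" by (rule exp_ge_add_one_self)
    then have "exp (- b * t) * (1 + b * (t - s)) \<le> exp (- b * t) * exp (b * (t - s))"
      by (intro mult_left_mono) auto
    also have "\<dots> = exp (- b * s)" by (simp add: exp_add[symmetric] algebra_simps)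
    finally have "B / b * (exp (- b * t) * (b * (t - s))) \<le> B / b * (exp (- b * s) - exp (- b * t))"
      using b nonneg by (intro mult_left_mono) (auto simp: algebra_simps)
    with bwd[OF st] b show "dist (\<sigma> s) (\<sigma> t) \<le>
        - (B / b * exp (- b * t)) - - (B / b * exp (- b * s))"
      by (simp add: algebra_simps)
  qed (use that in auto)
  show ?thesis
  proof (rule euclidean_length_le[of 0 D \<sigma> f])
    fix s t :: real assume st: "0 \<le> s" "s \<le> t" "t \<le> D"
    consider "t \<le> m" | "m \<le> s" | "s < m" "m < t" by linarith
    then show "dist (\<sigma> s) (\<sigma> t) \<le> f t - f s"
    proof cases
      case 1
      then show ?thesis using fwd'[of s t] st by (simp add: f_def)
    next
      case 2
      then show ?thesis using bwd'[of s t] st by (simp add: f_def)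
    next
      case 3
      then show ?thesis
        using fwd'[of s m] bwd'[of m t] st dist_triangle[of "\<sigma> s" "\<sigma> t" "\<sigma> m"]
        by (simp add: f_def)
    qed
    have "f t \<le> A / b * exp (b * m)"
    proof -
      have "A / b * exp (b * min t m) \<le> A / b * exp (b * m)"
        using b nonneg by (intro mult_left_mono) auto
      moreover have "0 \<le> B / b * exp (- b * max t m)" using b nonneg by simp
      ultimately show ?thesis unfolding f_def by linarith
    qed
    moreover have "- (B / b * exp (- b * m)) \<le> f s"
    proof -
      have "B / b * exp (- b * max s m) \<le> B / b * exp (- b * m)"
        using b nonneg by (intro mult_left_mono) auto
      moreover have "0 \<le> A / b * exp (b * min s m)" using b nonneg by simp
      ultimately show ?thesis unfolding f_def by linarith
    qed
    ultimately show "f t - f s \<le> (A * exp (b * m) + B * exp (- b * m)) / b"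
      by (simp add: add_divide_distrib)
  qed
qed

section \<open>From the growth of the boundary distance along a geodesic to the logarithmic
  bound\<close>

text \<open>A negative infimum would be approximated by a curve of negative length; off
  \<open>\<Omega>\<close> the default value is 0.\<close>

lemma finsler_dist_nonneg:
  assumes "open \<Omega>" "connected \<Omega>" "finsler_metric \<Omega> F"
  shows "0 \<le> finsler_dist \<Omega> F x y"
proof (rule ccontr)
  assume neg: "\<not> 0 \<le> finsler_dist \<Omega> F x y"
  then have "x \<in> \<Omega>" "y \<in> \<Omega>" by (auto simp: finsler_dist_def split: if_splits)
  then obtain \<gamma> where "piecewise_C1_curve \<gamma>" "\<gamma> ` {0..1} \<subseteq> \<Omega>" "finsler_length F \<gamma> < 0"
    using finsler_dist_approx[OF assms(1,2), of x y F 0] neg by auto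
  then show False using finsler_length_nonneg[OF assms(3)] by fastforce
qed

theorem theorem1p3:
  fixes \<Omega> :: "(complex ^ 'n) set"
    and F :: "complex ^ 'n \<Rightarrow> complex ^ 'n \<Rightarrow> real"
    and C1 C2 \<alpha> \<beta> :: real
  assumes dim: "CARD('n) \<ge> 2"
    and domain: "open \<Omega>" "connected \<Omega>" "\<Omega> \<noteq> {}" "bounded \<Omega>"
    and finsler: "finsler_metric \<Omega> F"
    and complete: "Metric_space.mcomplete \<Omega> (finsler_dist \<Omega> F)"
    and pos: "C1 > 0" "C2 > 0" "\<alpha> > 0" "0 < \<beta>" "\<beta> < 1"
    and dist_lower: "\<forall>x\<in>\<Omega>. \<forall>y\<in>\<Omega>.
          finsler_dist \<Omega> F x y \<ge> \<alpha> * \<bar>ln (bdist \<Omega> x / bdist \<Omega> y)\<bar> - C1"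
    and metric_lower: "\<forall>z\<in>\<Omega>. \<forall>X. X \<noteq> 0 \<longrightarrow>
          F z X \<ge> C2 * norm X / bdist \<Omega> z powr \<beta>"
  shows "\<exists>C>0. \<forall>x\<in>\<Omega>. \<forall>y\<in>\<Omega>. \<forall>\<sigma>. finsler_geodesic \<Omega> F x y \<sigma> \<longrightarrow>
           (let L = euclidean_length 0 (finsler_dist \<Omega> F x y) \<sigma> in
              L < \<infinity> \<and>
              finsler_dist \<Omega> F x y \<ge>
                2 * \<alpha> * ln ((enn2real L powr (1 / \<beta>) + max (bdist \<Omega> x) (bdist \<Omega> y)) /
                            sqrt (bdist \<Omega> x * bdist \<Omega> y)) - C)"
proof -
  define b where "b = \<beta> / \<alpha>"
  \<comment> \<open>The factor by which the boundary distance can grow within Finsler distance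
    2.\<close>
  define R where "R = exp ((2 + C1) / \<alpha>)"
  \<comment> \<open>In the exponent, \<open>2 + C1\<close> comes from \<open>R\<close>, another
    \<open>C1\<close> from comparing with an end of the geodesic, and 1 from replacing
    \<open>s\<close> by \<open>t\<close> in the backward estimate.\<close>
  define K where "K = exp (\<beta> * (3 + 2 * C1) / \<alpha>) / C2"
  \<comment> \<open>The sum of the factors of \<open>E\<close> in the bounds for the power of the
    length and for the larger boundary distance. The final constant is
    \<open>2 * \<alpha> * ln M\<close>, positive as \<open>M > 1\<close>.\<close>
  define M where "M = (2 * K / b) powr (1 / \<beta>) + exp (C1 / (2 * \<alpha>))"
  let ?d = "finsler_dist \<Omega> F" and ?\<delta> = "bdist \<Omega>"
  have b: "b > 0" and K: "K > 0" using pos by (auto simp: b_def K_def)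
  have "exp 0 < exp (C1 / (2 * \<alpha>))" using pos by (subst exp_less_cancel_iff) simp
  then have M: "M > 1" unfolding M_def by (simp add: add_nonneg_pos add_strict_increasing2)
  have \<delta>_pos: "0 < ?\<delta> z" if "z \<in> \<Omega>" for z
    using bdist_pos domain that by blast
  have ln_\<delta>_diff: "\<bar>ln (?\<delta> z) - ln (?\<delta> w)\<bar> \<le> (?d z w + C1) / \<alpha>" if "z \<in> \<Omega>" "w \<in> \<Omega>" for z w
  proof -
    have "\<alpha> * \<bar>ln (?\<delta> z) - ln (?\<delta> w)\<bar> \<le> ?d z w + C1"
      using dist_lower[rule_format, OF that] \<delta>_pos[OF that(1)] \<delta>_pos[OF that(2)]
      by (simp add: ln_div)
    then show ?thesis using pos by (simp add: field_simps)
  qed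
  have "let L = euclidean_length 0 (?d x y) \<sigma> in L < \<infinity> \<and>
      ?d x y \<ge> 2 * \<alpha> * ln ((enn2real L powr (1 / \<beta>) + max (?\<delta> x) (?\<delta> y)) / sqrt (?\<delta> x * ?\<delta> y))
        - 2 * \<alpha> * ln M"
    if xy: "x \<in> \<Omega>" "y \<in> \<Omega>" and geo: "finsler_geodesic \<Omega> F x y \<sigma>" for x y \<sigma>
  proof -
    define D where "D = ?d x y"
    define u where "u = ln (?\<delta> x)"
    define v where "v = ln (?\<delta> y)"
    have \<delta>x: "?\<delta> x = exp u" and \<delta>y: "?\<delta> y = exp v"
      using xy \<delta>_pos by (simp_all add: u_def v_def)
    have D: "D \<ge> 0" unfolding D_def by (rule finsler_dist_nonneg[OF domain(1,2) finsler])
    have \<sigma>: "\<sigma> s \<in> \<Omega>" if "0 \<le> s" "s \<le> D" for s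
      using geo that by (auto simp: finsler_geodesic_def D_def)
    have d_\<sigma>: "?d (\<sigma> s) (\<sigma> t) = \<bar>s - t\<bar>" if "0 \<le> s" "s \<le> D" "0 \<le> t" "t \<le> D" for s t
      using geo that by (auto simp: finsler_geodesic_def D_def)
    have \<sigma>_ends: "\<sigma> 0 = x" "\<sigma> D = y" using geo by (auto simp: finsler_geodesic_def D_def)
    \<comment> \<open>\<open>w\<close> is any bound for the logarithm of
      \<open>R * ?\<delta> (\<sigma> s)\<close>, left open so that the estimates from both ends of
      the geodesic can be inserted.\<close>
    have local: "dist (\<sigma> s) (\<sigma> t) \<le> exp (\<beta> * w) / C2 * (t - s)"
      if st: "0 \<le> s" "s \<le> t" "t \<le> D" "t - s \<le> 1"
        and w: "(2 + C1) / \<alpha> + ln (?\<delta> (\<sigma> s)) \<le> w" for s t w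
    proof -
      have p: "\<sigma> s \<in> \<Omega>" "\<sigma> t \<in> \<Omega>" using st by (auto intro: \<sigma>)
      have "?\<delta> z \<le> R * ?\<delta> (\<sigma> s)" if z: "z \<in> \<Omega>" "?d (\<sigma> s) z \<le> 2" for z
      proof -
        have "(?d (\<sigma> s) z + C1) / \<alpha> \<le> (2 + C1) / \<alpha>"
          using z pos by (intro divide_right_mono) auto
        then have "ln (?\<delta> z) \<le> (2 + C1) / \<alpha> + ln (?\<delta> (\<sigma> s))"
          using ln_\<delta>_diff[OF p(1) z(1)] by linarith
        then have "exp (ln (?\<delta> z)) \<le> exp ((2 + C1) / \<alpha> + ln (?\<delta> (\<sigma> s)))" by simp
        then show ?thesis using \<delta>_pos[OF z(1)] \<delta>_pos[OF p(1)] by (simp add: exp_add R_def)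
      qed
      then have "dist (\<sigma> s) (\<sigma> t) \<le> (R * ?\<delta> (\<sigma> s)) powr \<beta> / C2 * ?d (\<sigma> s) (\<sigma> t)"
        using d_\<sigma>[of s t] st pos p metric_lower
        by (intro dist_le_finsler_dist[OF domain(1,2,4) finsler]) auto
      also have "?d (\<sigma> s) (\<sigma> t) = t - s" using d_\<sigma>[of s t] st by simp
      also have "R * ?\<delta> (\<sigma> s) = exp ((2 + C1) / \<alpha> + ln (?\<delta> (\<sigma> s)))"
        using \<delta>_pos[OF p(1)] by (simp add: exp_add R_def)
      also have "\<dots> powr \<beta> / C2 * (t - s) \<le> exp (\<beta> * w) / C2 * (t - s)"
        using w pos st
        by (intro mult_right_mono divide_right_mono) (auto simp: exp_powr_real mult.commute)
      finally show ?thesis .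
    qed
    \<comment> \<open>The parameter where the two exponentials cross, that is, the solution of
      \<open>u + s / \<alpha> = v + (D - s) / \<alpha>\<close> for \<open>s\<close>.\<close>
    define m where "m = D / 2 + \<alpha> / 2 * (v - u)"
    define A where "A = K * exp (\<beta> * u)"
    define B where "B = K * exp (b * D + \<beta> * v)"
    define E where "E = exp ((u + v) / 2 + D / (2 * \<alpha>))"
    have "euclidean_length 0 D \<sigma> \<le> ennreal ((A * exp (b * m) + B * exp (- b * m)) / b)"
    proof (rule euclidean_length_le_two_sided_exp[OF b])
      show "A \<ge> 0" "B \<ge> 0" using K by (auto simp: A_def B_def)
    next
      fix s t assume st: "0 \<le> s" "s \<le> t" "t \<le> D" "t - s \<le> 1"
      have "ln (?\<delta> (\<sigma> s)) \<le> u + (s + C1) / \<alpha>"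
        using ln_\<delta>_diff[of x "\<sigma> s"] d_\<sigma>[of 0 s] \<sigma>_ends st xy \<sigma> by (simp add: u_def abs_le_iff)
      moreover have "(3 + 2 * C1) / \<alpha> + u + s / \<alpha> = (2 + C1) / \<alpha> + (u + (s + C1) / \<alpha>) + 1 / \<alpha>"
        using pos by (simp add: field_simps)
      \<comment> \<open>The forward estimate has \<open>1 / \<alpha>\<close> to spare; giving it
        away lets both directions share \<open>K\<close>.\<close>
      moreover have "0 < 1 / \<alpha>" using pos by simp
      ultimately have "(2 + C1) / \<alpha> + ln (?\<delta> (\<sigma> s)) \<le> (3 + 2 * C1) / \<alpha> + u + s / \<alpha>"
        by linarith
      from local[OF st this]
      have "dist (\<sigma> s) (\<sigma> t) \<le> exp (\<beta> * ((3 + 2 * C1) / \<alpha> + u + s / \<alpha>)) / C2 * (t - s)" .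
      also have "exp (\<beta> * ((3 + 2 * C1) / \<alpha> + u + s / \<alpha>)) / C2 = A * exp (b * s)"
        by (simp add: A_def K_def b_def exp_add[symmetric] algebra_simps)
      finally show "dist (\<sigma> s) (\<sigma> t) \<le> A * exp (b * s) * (t - s)" .
      have "ln (?\<delta> (\<sigma> s)) \<le> v + (D - s + C1) / \<alpha>"
        using ln_\<delta>_diff[of "\<sigma> s" y] d_\<sigma>[of s D] \<sigma>_ends st xy \<sigma> by (simp add: v_def abs_le_iff)
      \<comment> \<open>The backward bound must be stated at the right end \<open>t\<close>, where
        its exponential is smallest; this costs at most 1 since
        \<open>t - s \<le> 1\<close>.\<close>
      also have "\<dots> \<le> v + (D - t + 1 + C1) / \<alpha>"
        using st pos by (intro add_left_mono divide_right_mono) auto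
      finally have "ln (?\<delta> (\<sigma> s)) \<le> v + (D - t + 1 + C1) / \<alpha>" .
      moreover have "(3 + 2 * C1) / \<alpha> + v + (D - t) / \<alpha> = (2 + C1) / \<alpha> + (v + (D - t + 1 + C1) / \<alpha>)"
        using pos by (simp add: field_simps)
      ultimately have "(2 + C1) / \<alpha> + ln (?\<delta> (\<sigma> s)) \<le> (3 + 2 * C1) / \<alpha> + v + (D - t) / \<alpha>"
        by linarith
      from local[OF st this]
      have "dist (\<sigma> s) (\<sigma> t) \<le> exp (\<beta> * ((3 + 2 * C1) / \<alpha> + v + (D - t) / \<alpha>)) / C2 * (t - s)" .
      also have "exp (\<beta> * ((3 + 2 * C1) / \<alpha> + v + (D - t) / \<alpha>)) / C2 = B * exp (- b * t)"
        by (simp add: B_def K_def b_def exp_add[symmetric] diff_divide_distrib algebra_simps)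
      finally show "dist (\<sigma> s) (\<sigma> t) \<le> B * exp (- b * t) * (t - s)" .
    qed
    \<comment> \<open>At the crossing both exponents equal \<open>\<beta>\<close> times the
      logarithm of \<open>E\<close>, so the two halves contribute equally.\<close>
    also have "(A * exp (b * m) + B * exp (- b * m)) / b = 2 * K / b * E powr \<beta>"
    proof -
      have "\<beta> * u + b * m = \<beta> * ((u + v) / 2 + D / (2 * \<alpha>))"
        "b * D + \<beta> * v + - b * m = \<beta> * ((u + v) / 2 + D / (2 * \<alpha>))"
        using pos by (simp_all add: b_def m_def field_simps)
      then have "exp (\<beta> * u) * exp (b * m) = E powr \<beta>"
        "exp (b * D + \<beta> * v) * exp (- b * m) = E powr \<beta>"
        unfolding exp_add[symmetric] E_def by (simp_all add: exp_powr_real mult.commute)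
      then have "A * exp (b * m) = K * E powr \<beta>" "B * exp (- b * m) = K * E powr \<beta>"
        unfolding A_def B_def by (simp_all only: mult.assoc)
      then show ?thesis by simp
    qed
    finally have L: "euclidean_length 0 D \<sigma> \<le> ennreal (2 * K / b * E powr \<beta>)" .
    define L where "L = enn2real (euclidean_length 0 D \<sigma>)"
    have "L \<le> 2 * K / b * E powr \<beta>"
      unfolding L_def using K b by (intro enn2real_leI L) (simp add: E_def)
    \<comment> \<open>The power \<open>1 / \<beta>\<close> makes the bound linear in
      \<open>E\<close>, so that it can be added to the bound for the boundary distances.\<close>
    then have "L powr (1 / \<beta>) \<le> (2 * K / b * E powr \<beta>) powr (1 / \<beta>)"
      using pos by (intro powr_mono2) (auto simp: L_def)
    also have "\<dots> = (2 * K / b) powr (1 / \<beta>) * E"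
      unfolding powr_mult using pos by (simp add: powr_powr E_def)
    finally have L_powr: "L powr (1 / \<beta>) \<le> (2 * K / b) powr (1 / \<beta>) * E" .
    have "\<bar>u - v\<bar> \<le> (D + C1) / \<alpha>"
      unfolding u_def v_def D_def by (rule ln_\<delta>_diff[OF xy])
    \<comment> \<open>The maximum is half of the sum plus half of the absolute difference.\<close>
    then have "max u v \<le> (u + v + (D + C1) / \<alpha>) / 2"
      by (simp add: abs_le_iff max_def)
    also have "\<dots> = C1 / (2 * \<alpha>) + ((u + v) / 2 + D / (2 * \<alpha>))"
      using pos by (simp add: field_simps)
    finally have "u \<le> C1 / (2 * \<alpha>) + ((u + v) / 2 + D / (2 * \<alpha>))"
      "v \<le> C1 / (2 * \<alpha>) + ((u + v) / 2 + D / (2 * \<alpha>))"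
      by simp_all
    then have "max (?\<delta> x) (?\<delta> y) \<le> exp (C1 / (2 * \<alpha>)) * E"
      by (simp add: \<delta>x \<delta>y E_def exp_add[symmetric])
    with L_powr have "L powr (1 / \<beta>) + max (?\<delta> x) (?\<delta> y) \<le> M * E"
      unfolding M_def distrib_right by (rule add_mono)
    \<comment> \<open>The geometric mean of the boundary distances cancels against \<open>E\<close>
      and leaves \<open>exp (D / (2 * \<alpha>))\<close>.\<close>
    moreover have sqrt_eq: "sqrt (?\<delta> x * ?\<delta> y) = exp ((u + v) / 2)"
      by (rule real_sqrt_unique) (simp_all add: \<delta>x \<delta>y power2_eq_square exp_add[symmetric])
    moreover have "E = exp (D / (2 * \<alpha>)) * exp ((u + v) / 2)"
      by (simp add: E_def exp_add)
    ultimately have "(L powr (1 / \<beta>) + max (?\<delta> x) (?\<delta> y)) / sqrt (?\<delta> x * ?\<delta> y) \<le> M * exp (D / (2 * \<alpha>))"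
      by (simp add: divide_le_eq mult.assoc)
    \<comment> \<open>Needed for monotonicity of \<open>ln\<close>. \<open>L\<close> can vanish, as
      for \<open>x = y\<close>, so positivity comes from the boundary distances.\<close>
    moreover have "0 < (L powr (1 / \<beta>) + max (?\<delta> x) (?\<delta> y)) / sqrt (?\<delta> x * ?\<delta> y)"
      unfolding sqrt_eq by (intro divide_pos_pos add_nonneg_pos) (auto simp: \<delta>x less_max_iff_disj)
    ultimately have "ln ((L powr (1 / \<beta>) + max (?\<delta> x) (?\<delta> y)) / sqrt (?\<delta> x * ?\<delta> y)) \<le>
        ln (M * exp (D / (2 * \<alpha>)))"
      using M by (subst ln_le_cancel_iff) auto
    also have "\<dots> = ln M + D / (2 * \<alpha>)" using M by (simp add: ln_mult)
    finally have "2 * \<alpha> * ln ((L powr (1 / \<beta>) + max (?\<delta> x) (?\<delta> y)) / sqrt (?\<delta> x * ?\<delta> y)) \<le>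
        2 * \<alpha> * (ln M + D / (2 * \<alpha>))"
      using pos by (intro mult_left_mono) auto
    also have "\<dots> = 2 * \<alpha> * ln M + D" using pos by (simp add: field_simps)
    finally have "D \<ge> 2 * \<alpha> * ln ((L powr (1 / \<beta>) + max (?\<delta> x) (?\<delta> y)) / sqrt (?\<delta> x * ?\<delta> y))
        - 2 * \<alpha> * ln M" by simp
    \<comment> \<open>\<open>enn2real\<close> sends infinity to 0, so finiteness is what makes
      \<open>L\<close> the actual length.\<close>
    moreover have "euclidean_length 0 D \<sigma> < \<infinity>"
      using L by (rule le_less_trans) simp
    ultimately show ?thesis by (simp add: Let_def L_def D_def)
  qed
  moreover have "2 * \<alpha> * ln M > 0" using M pos by simp
  ultimately show ?thesis by (intro exI[of _ "2 * \<alpha> * ln M"]) blast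
qed

end
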